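(* Let $p$ be an odd prime and let $\alpha,\beta$ be $p$-integral rational numbers. If $\{\alpha\}_p\geq 1$, $\{\beta\}_p\geq 1$ and $\{\alpha\}_p+\{\beta\}_p\leq p$, then $$ {}_3F_2\bigg[\begin{matrix}\alpha&\beta&1-\alpha-\beta\\&1&1\end{matrix}\bigg|1\bigg]_p=\sum_{k=0}^{p-1}\frac{(\alpha)_k(\beta)_k(1-\alpha-\beta)_k}{(k!)^3}\equiv0\pmod{p^2}. $$
   Context: A rational number is $p$-integral if its denominator (in lowest terms) is not divisible by $p$; congruences modulo $p^2$ are taken in the ring of $p$-integral rationals. For a $p$-integral $\alpha$, $\{\alpha\}_p$ denotes the least non-negative residue of $\alpha$ modulo $p$, i.e. the unique integer $r\in\{0,1,\dots,p-1\}$ with $\alpha\equiv r\pmod p$. The Pochhammer symbol is $(\alpha)_0=1$ and $(\alpha)_k=\alpha(\alpha+1)\cdots(\alpha+k-1)$ for $k\geq1$. The truncated hypergeometric function is ${}_pF_q\big[\begin{smallmatrix}\alpha_1&\ldots&\alpha_p\\\beta_1&\ldots&\beta_q\end{smallmatrix}\big|x\big]_n=\sum_{k=0}^{n-1}\frac{(\alpha_1)_k\cdots(\alpha_p)_k}{(\beta_1)_k\cdots(\beta_q)_k}\cdot\frac{x^k}{k!}$. *)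

theory Defs
  imports Complex_Main "HOL-Number_Theory.Cong"
begin

definition p_integral :: "nat \<Rightarrow> rat \<Rightarrow> bool" where
  "p_integral p a \<longleftrightarrow> \<not> int p dvd snd (quotient_of a)"

text \<open>Congruence modulo the ideal generated by \<open>m\<close> in the ring of \<open>p\<close>-integral rationals.
  Both sides are required to lie in that ring.\<close>

definition p_integral_cong :: "nat \<Rightarrow> nat \<Rightarrow> rat \<Rightarrow> rat \<Rightarrow> bool" where
  "p_integral_cong p m a b \<longleftrightarrow>
     p_integral p a \<and> p_integral p b \<and> (\<exists>c. p_integral p c \<and> a - b = of_nat m * c)"

definition least_residue :: "nat \<Rightarrow> rat \<Rightarrow> nat" where
  "least_residue p a = (THE r. r < p \<and> p_integral_cong p p a (of_nat r))"

definition truncated_hypergeometric ::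
    "'a::field_char_0 list \<Rightarrow> 'a list \<Rightarrow> 'a \<Rightarrow> nat \<Rightarrow> 'a" where
  "truncated_hypergeometric as bs x n =
     (\<Sum>k<n. (\<Prod>a\<leftarrow>as. pochhammer a k) / (\<Prod>b\<leftarrow>bs. pochhammer b k) * (x ^ k / fact k))"

lemma p_integral_of_int: "prime p \<Longrightarrow> p_integral p (of_int n)"
  by (auto simp: p_integral_def dest: prime_gt_1_nat)

lemma p_integralE:
  assumes "prime p" "p_integral p a"
  obtains x y where "a = of_int x / of_int y" "y > 0" "coprime y (int p)"
proof (rule that)
  obtain x y where xy: "quotient_of a = (x, y)" by force
  show "a = of_int (fst (quotient_of a)) / of_int (snd (quotient_of a))"
    using quotient_of_div[OF xy] xy by simp
  show "snd (quotient_of a) > 0"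
    using quotient_of_denom_pos[OF xy] xy by simp
  show "coprime (snd (quotient_of a)) (int p)"
    using assms by (auto simp: p_integral_def coprime_commute intro!: prime_imp_coprime)
qed

lemma p_integral_divide:
  assumes "prime p" "\<not> int p dvd y"
  shows "p_integral p (of_int x / of_int y)"
proof -
  obtain u v where uv: "quotient_of (of_int x / of_int y) = (u, v)" by force
  have y: "y \<noteq> 0" using assms(2) by auto
  have v: "v > 0" and cop: "coprime u v"
    using quotient_of_denom_pos[OF uv] quotient_of_coprime[OF uv] by auto
  have "(of_int x / of_int y :: rat) = of_int u / of_int v"
    using quotient_of_div[OF uv] .
  hence "(of_int (x * v) :: rat) = of_int (u * y)"
    using y v by (simp add: field_simps)
  hence "x * v = u * y" by (simp only: of_int_eq_iff)
  hence "v dvd y" using cop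
    by (metis coprime_commute coprime_dvd_mult_right_iff dvd_triv_right)
  thus ?thesis using assms(2) uv by (auto simp: p_integral_def dest: dvd_trans)
qed

lemma least_residue_unique_exists:
  assumes p: "prime p" and a: "p_integral p a"
  shows "\<exists>!r. r < p \<and> p_integral_cong p p a (of_nat r)"
proof -
  obtain x y where xy: "a = of_int x / of_int y" "y > 0" "coprime y (int p)"
    using p_integralE[OF p a] .
  have ndvd: "\<not> int p dvd y"
    using xy(3) p by (metis coprime_absorb_right not_prime_unit prime_int_nat_transfer nat_int
        prime_nat_int_transfer)
  have p0: "int p > 0" using prime_gt_0_nat[OF p] by simp
  have iff: "p_integral_cong p p a (of_nat r) \<longleftrightarrow> [y * int r = x] (mod int p)" for r
  proof
    assume "p_integral_cong p p a (of_nat r)"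
    then obtain c where c: "p_integral p c" "a - of_nat r = of_nat p * c"
      by (auto simp: p_integral_cong_def)
    obtain u v where uv: "c = of_int u / of_int v" "v > 0" "coprime v (int p)"
      using p_integralE[OF p c(1)] .
    have "(of_int ((x - y * int r) * v) :: rat) = of_int (int p * (u * y))"
      using c(2) xy(2) uv(2) by (simp add: xy(1) uv(1) field_simps)
    hence "(x - y * int r) * v = int p * (u * y)" by (simp only: of_int_eq_iff)
    hence "int p dvd (x - y * int r) * v" by simp
    hence "int p dvd x - y * int r"
      using uv(3) by (simp add: coprime_commute coprime_dvd_mult_left_iff)
    thus "[y * int r = x] (mod int p)" by (simp add: cong_iff_dvd_diff dvd_diff_commute)
  next
    assume "[y * int r = x] (mod int p)"
    then obtain k where k: "x - y * int r = int p * k"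
      by (auto simp: cong_iff_dvd_diff dvd_diff_commute elim!: dvdE)
    have x: "x = int p * k + y * int r" using k by simp
    have "a - of_nat r = of_nat p * (of_int k / of_int y)"
      using xy(2) by (simp add: xy(1) x field_simps)
    moreover have "p_integral p (of_nat r)" using p_integral_of_int[OF p, of "int r"] by simp
    ultimately show "p_integral_cong p p a (of_nat r)"
      using a p_integral_divide[OF p ndvd, of k] by (auto simp: p_integral_cong_def)
  qed
  obtain z where z: "[y * z = 1] (mod int p)"
    using xy(3) coprime_iff_invertible_int by blast
  define r0 where "r0 = nat (z * x mod int p)"
  have r0: "int r0 = z * x mod int p" using p0 by (simp add: r0_def)
  have "[y * int r0 = (y * z) * x] (mod int p)"
    by (simp add: r0 cong_def mod_simps mult.assoc)
  also have "[(y * z) * x = 1 * x] (mod int p)" using z by (rule cong_scalar_right)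
  finally have r0_cong: "[y * int r0 = x] (mod int p)" by simp
  have "int r0 < int p" using p0 by (simp add: r0)
  hence r0_less: "r0 < p" by simp
  show ?thesis
  proof (rule ex1I)
    show "r0 < p \<and> p_integral_cong p p a (of_nat r0)"
      using r0_less r0_cong iff by blast
    fix r assume r: "r < p \<and> p_integral_cong p p a (of_nat r)"
    have "[y * int r = y * int r0] (mod int p)"
      using r iff r0_cong cong_sym cong_trans by blast
    hence "[int r = int r0] (mod int p)"
      using xy(3) by (simp add: cong_mult_lcancel)
    thus "r = r0" using r r0_less by (simp add: cong_def)
  qed
qed

end

theory Submission
  imports Defs "HOL-Computational_Algebra.Polynomial"
begin

text \<open>
  Write \<open>\<alpha> = a + p s\<close>, \<open>\<beta> = b + p t\<close> and \<open>1 - \<alpha> - \<beta> = c + p u\<close>, where \<open>a, b, c \<ge> 1\<close> are integers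
  with \<open>a + b + c = p + 1\<close> and hence \<open>s + t + u = - 1\<close>. Modulo \<open>p\<^sup>2\<close> the sum is an affine function
  of \<open>(s, t, u)\<close>, so it suffices that it vanishes at \<open>(-1, 0, 0)\<close>, \<open>(0, -1, 0)\<close> and \<open>(0, 0, -1)\<close>.
  At \<open>(-1, 0, 0)\<close>, with \<open>n = p - a = b + c - 1\<close>, it is up to sign the \<open>n\<close>-th finite difference at \<open>0\<close>
  of the polynomial \<open>(k+1)\<^sub>b\<^sub>-\<^sub>1 (k+1)\<^sub>c\<^sub>-\<^sub>1 / ((b-1)! (c-1)!)\<close> of degree \<open>n - 1\<close> in \<open>k\<close>, hence zero.
  The other two points follow by symmetry.
\<close>

section \<open>Arithmetic of \<open>p\<close>-integral rationals\<close>

lemma p_integral_of_nat: "prime p \<Longrightarrow> p_integral p (of_nat n)"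
  using p_integral_of_int[of p "int n"] by simp

lemma p_integral_0: "prime p \<Longrightarrow> p_integral p 0"
  and p_integral_1: "prime p \<Longrightarrow> p_integral p 1"
  using p_integral_of_nat[of p 0] p_integral_of_nat[of p 1] by simp_all

text \<open>The form of \<open>p_integralE\<close> with non-divisibility of the denominator, which
  passes to products by primality and is what \<open>p_integral_divide\<close> consumes.\<close>

lemma p_integral_repr:
  assumes "prime p" "p_integral p a"
  obtains x y where "a = of_int x / of_int y" "y \<noteq> 0" "\<not> int p dvd y"
proof -
  obtain x y where xy: "a = of_int x / of_int y" "y > 0" "coprime y (int p)"
    using p_integralE[OF assms] .
  have "\<not> int p dvd y"
    using xy(3) assms(1)
    by (metis coprime_absorb_right not_prime_unit prime_nat_int_transfer)
  with xy show ?thesis using that[of x y] by simp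
qed

lemma p_integral_add:
  assumes p: "prime p" and "p_integral p a" "p_integral p b"
  shows "p_integral p (a + b)"
proof -
  obtain x y where xy: "a = of_int x / of_int y" "y \<noteq> 0" "\<not> int p dvd y"
    using p_integral_repr[OF p assms(2)] .
  obtain u v where uv: "b = of_int u / of_int v" "v \<noteq> 0" "\<not> int p dvd v"
    using p_integral_repr[OF p assms(3)] .
  have "a + b = of_int (x * v + u * y) / of_int (y * v)"
    using xy uv by (simp add: field_simps)
  moreover have "\<not> int p dvd y * v"
    using p xy(3) uv(3) by (simp add: prime_dvd_mult_iff)
  ultimately show ?thesis using p_integral_divide[OF p] by metis
qed

lemma p_integral_mult:
  assumes p: "prime p" and "p_integral p a" "p_integral p b"
  shows "p_integral p (a * b)"
proof -
  obtain x y where xy: "a = of_int x / of_int y" "y \<noteq> 0" "\<not> int p dvd y"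
    using p_integral_repr[OF p assms(2)] .
  obtain u v where uv: "b = of_int u / of_int v" "v \<noteq> 0" "\<not> int p dvd v"
    using p_integral_repr[OF p assms(3)] .
  have "a * b = of_int (x * u) / of_int (y * v)"
    using xy uv by simp
  moreover have "\<not> int p dvd y * v"
    using p xy(3) uv(3) by (simp add: prime_dvd_mult_iff)
  ultimately show ?thesis using p_integral_divide[OF p] by metis
qed

lemma p_integral_minus:
  assumes p: "prime p" and "p_integral p a"
  shows "p_integral p (- a)"
  using p_integral_mult[OF p p_integral_of_int[OF p, of "-1"] assms(2)] by simp

lemma p_integral_diff:
  assumes p: "prime p" and "p_integral p a" "p_integral p b"
  shows "p_integral p (a - b)"
  using p_integral_add[OF p assms(2) p_integral_minus[OF p assms(3)]] by simp

lemma p_integral_power: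
  assumes p: "prime p" and "p_integral p a"
  shows "p_integral p (a ^ n)"
  by (induction n) (simp_all add: p_integral_1 p_integral_mult assms)

lemmas p_integral_intros =
  p_integral_0 p_integral_1 p_integral_of_nat p_integral_add p_integral_mult
  p_integral_minus p_integral_diff p_integral_power

text \<open>For \<open>k < p\<close> all factors of \<open>k!\<close> are prime to \<open>p\<close>;
  this keeps every term of the truncated sum \<open>p\<close>-integral.\<close>

lemma p_integral_inverse_fact:
  assumes p: "prime p" and "k < p"
  shows "p_integral p (1 / fact k)"
proof -
  have "\<not> p dvd fact k"
    using p \<open>k < p\<close> by (simp add: prime_dvd_fact_iff)
  hence "\<not> int p dvd int (fact k)" by (simp only: int_dvd_int_iff not_False_eq_True)
  from p_integral_divide[OF p this, of 1] show ?thesis by simp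
qed

section \<open>Congruence calculus for \<open>p\<close>-integral rationals\<close>

lemma p_integral_cong_refl:
  "prime p \<Longrightarrow> p_integral p a \<Longrightarrow> p_integral_cong p m a a"
  by (auto simp: p_integral_cong_def intro!: exI[of _ 0] p_integral_0)

lemma p_integral_congI:
  assumes p: "prime p" and "p_integral p b" "p_integral p c" "a = b + of_nat m * c"
  shows "p_integral_cong p m a b"
  unfolding p_integral_cong_def using assms by (auto intro!: p_integral_intros)

lemma p_integral_congD:
  assumes "p_integral_cong p m a b"
  shows "p_integral p a" "p_integral p b"
  using assms by (simp_all add: p_integral_cong_def)

lemma p_integral_congE:
  assumes "p_integral_cong p m a b"
  obtains c where "p_integral p c" "a = b + of_nat m * c"
  using assms unfolding p_integral_cong_def by (metis add.commute diff_add_cancel)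

lemma p_integral_cong_trans:
  assumes p: "prime p" and ab: "p_integral_cong p m a b" and bc: "p_integral_cong p m b c"
  shows "p_integral_cong p m a c"
proof -
  obtain x where x: "p_integral p x" "a = b + of_nat m * x" using p_integral_congE[OF ab] .
  obtain y where y: "p_integral p y" "b = c + of_nat m * y" using p_integral_congE[OF bc] .
  show ?thesis
    by (rule p_integral_congI[OF p, where c = "y + x"])
      (use x y p_integral_congD[OF bc] in \<open>auto simp: algebra_simps intro!: p_integral_intros p\<close>)
qed

lemma p_integral_cong_sym:
  assumes p: "prime p" and ab: "p_integral_cong p m a b"
  shows "p_integral_cong p m b a"
proof -
  obtain x where x: "p_integral p x" "a = b + of_nat m * x" using p_integral_congE[OF ab] .
  show ?thesis
    by (rule p_integral_congI[OF p, where c = "- x"])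
      (use x p_integral_congD[OF ab] in \<open>auto intro!: p_integral_intros p\<close>)
qed

lemma p_integral_cong_add:
  assumes p: "prime p" and ab: "p_integral_cong p m a b" and cd: "p_integral_cong p m c d"
  shows "p_integral_cong p m (a + c) (b + d)"
proof -
  obtain x where x: "p_integral p x" "a = b + of_nat m * x" using p_integral_congE[OF ab] .
  obtain y where y: "p_integral p y" "c = d + of_nat m * y" using p_integral_congE[OF cd] .
  show ?thesis
    by (rule p_integral_congI[OF p, where c = "x + y"])
      (use x y p_integral_congD[OF ab] p_integral_congD[OF cd]
        in \<open>auto simp: algebra_simps intro!: p_integral_intros p\<close>)
qed

lemma p_integral_cong_mult:
  assumes p: "prime p" and ab: "p_integral_cong p m a b" and cd: "p_integral_cong p m c d"
  shows "p_integral_cong p m (a * c) (b * d)"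
proof -
  obtain x where x: "p_integral p x" "a = b + of_nat m * x" using p_integral_congE[OF ab] .
  obtain y where y: "p_integral p y" "c = d + of_nat m * y" using p_integral_congE[OF cd] .
  show ?thesis
  proof (rule p_integral_congI[OF p, where c = "x * c + b * y"])
    show "a * c = b * d + of_nat m * (x * c + b * y)"
      unfolding x(2) y(2) by (simp add: algebra_simps)
  qed (use x y p_integral_congD[OF ab] p_integral_congD[OF cd] in \<open>auto intro!: p_integral_intros p\<close>)
qed

section \<open>First-order expansions modulo \<open>p\<^sup>2\<close>\<close>

text \<open>\<open>A\<close> is \<open>(a)_k\<close> and \<open>B\<close> its derivative in
  \<open>a\<close>, built up by the product rule. Only their existence and their independence of
  \<open>s\<close> matter later, so no closed form is recorded.\<close>

lemma pochhammer_expansion: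
  assumes p: "prime p"
  shows "\<exists>A B. p_integral p A \<and> p_integral p B \<and>
           (\<forall>s. p_integral p s \<longrightarrow>
             p_integral_cong p (p\<^sup>2) (pochhammer (of_nat a + of_nat p * s) k) (A + of_nat p * (s * B)))"
proof (induction k)
  case 0
  show ?case
    by (rule exI[of _ 1], rule exI[of _ 0]) (auto intro!: p_integral_intros p_integral_cong_refl p)
next
  case (Suc k)
  then obtain A B where AB: "p_integral p A" "p_integral p B"
    and cong: "\<And>s. p_integral p s \<Longrightarrow>
      p_integral_cong p (p\<^sup>2) (pochhammer (of_nat a + of_nat p * s) k) (A + of_nat p * (s * B))"
    by blast
  have "p_integral_cong p (p\<^sup>2) (pochhammer (of_nat a + of_nat p * s) (Suc k))
      (A * of_nat (a + k) + of_nat p * (s * (A + B * of_nat (a + k))))" if s: "p_integral p s" for s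
  proof (rule p_integral_cong_trans[OF p])
    show "p_integral_cong p (p\<^sup>2) (pochhammer (of_nat a + of_nat p * s) (Suc k))
       ((A + of_nat p * (s * B)) * (of_nat a + of_nat p * s + of_nat k))"
      unfolding pochhammer_Suc
      by (intro p_integral_cong_mult cong s p p_integral_cong_refl p_integral_intros)
    show "p_integral_cong p (p\<^sup>2) ((A + of_nat p * (s * B)) * (of_nat a + of_nat p * s + of_nat k))
       (A * of_nat (a + k) + of_nat p * (s * (A + B * of_nat (a + k))))"
      \<comment> \<open>Multiplying out, the only second-order term is
        \<open>p\<^sup>2 * s\<^sup>2 * B\<close>.\<close>
      by (rule p_integral_congI[OF p, where c = "s\<^sup>2 * B"])
        (auto simp: algebra_simps power2_eq_square intro!: p_integral_intros p s AB)
  qed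
  moreover have "p_integral p (A * of_nat (a + k))" "p_integral p (A + B * of_nat (a + k))"
    by (intro p_integral_intros p AB)+
  ultimately show ?case by blast
qed

definition hyp_sum :: "nat \<Rightarrow> rat \<Rightarrow> rat \<Rightarrow> rat \<Rightarrow> rat" where
  "hyp_sum n x y z = (\<Sum>k<n. pochhammer x k * pochhammer y k * pochhammer z k / fact k ^ 3)"

text \<open>Each term is a product of three affine expansions, again affine modulo
  \<open>p\<^sup>2\<close>. The coefficients are chosen before \<open>s\<close>, \<open>t\<close>,
  \<open>u\<close>, so one expansion serves every point; \<open>n \<le> p\<close> keeps the
  factorials invertible.\<close>

lemma hyp_sum_expansion:
  assumes p: "prime p" and "n \<le> p"
  shows "\<exists>P Q R V. p_integral p P \<and> p_integral p Q \<and> p_integral p R \<and> p_integral p V \<and>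
           (\<forall>s t u. p_integral p s \<longrightarrow> p_integral p t \<longrightarrow> p_integral p u \<longrightarrow>
             p_integral_cong p (p\<^sup>2)
               (hyp_sum n (of_nat a + of_nat p * s) (of_nat b + of_nat p * t) (of_nat c + of_nat p * u))
               (P + of_nat p * (s * Q + t * R + u * V)))"
  using \<open>n \<le> p\<close>
proof (induction n)
  case 0
  show ?case
    by (intro exI[of _ 0]) (auto simp: hyp_sum_def intro!: p_integral_intros p_integral_cong_refl p)
next
  case (Suc n)
  have "n \<le> p" using Suc.prems by simp
  from Suc.IH[OF this] obtain P Q R V where PQ: "p_integral p P" "p_integral p Q" "p_integral p R" "p_integral p V"
    and cong: "\<And>s t u. p_integral p s \<Longrightarrow> p_integral p t \<Longrightarrow> p_integral p u \<Longrightarrow>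
      p_integral_cong p (p\<^sup>2)
        (hyp_sum n (of_nat a + of_nat p * s) (of_nat b + of_nat p * t) (of_nat c + of_nat p * u))
        (P + of_nat p * (s * Q + t * R + u * V))"
    by blast
  obtain A A' where A: "p_integral p A" "p_integral p A'" "\<And>s. p_integral p s \<Longrightarrow>
      p_integral_cong p (p\<^sup>2) (pochhammer (of_nat a + of_nat p * s) n) (A + of_nat p * (s * A'))"
    using pochhammer_expansion[OF p, of a n] by blast
  obtain B B' where B: "p_integral p B" "p_integral p B'" "\<And>s. p_integral p s \<Longrightarrow>
      p_integral_cong p (p\<^sup>2) (pochhammer (of_nat b + of_nat p * s) n) (B + of_nat p * (s * B'))"
    using pochhammer_expansion[OF p, of b n] by blast
  obtain C C' where C: "p_integral p C" "p_integral p C'" "\<And>s. p_integral p s \<Longrightarrow>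
      p_integral_cong p (p\<^sup>2) (pochhammer (of_nat c + of_nat p * s) n) (C + of_nat p * (s * C'))"
    using pochhammer_expansion[OF p, of c n] by blast
  define f :: rat where "f = (1 / fact n) ^ 3"
  have f: "p_integral p f"
    unfolding f_def using p_integral_inverse_fact[OF p, of n] Suc.prems
    by (auto intro!: p_integral_power p)
  \<comment> \<open>The new term contributes its value at \<open>s = t = u = 0\<close> and, by the
    product rule, its three first-order coefficients.\<close>
  define P' Q' R' V' where "P' = P + A * B * C * f" and "Q' = Q + A' * B * C * f"
    and "R' = R + A * B' * C * f" and "V' = V + A * B * C' * f"
  note integral = PQ A(1,2) B(1,2) C(1,2) f
  have "p_integral_cong p (p\<^sup>2)
      (hyp_sum (Suc n) (of_nat a + of_nat p * s) (of_nat b + of_nat p * t) (of_nat c + of_nat p * u))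
      (P' + of_nat p * (s * Q' + t * R' + u * V'))"
    if stu: "p_integral p s" "p_integral p t" "p_integral p u" for s t u
  proof (rule p_integral_cong_trans[OF p])
    let ?q = "of_nat p :: rat"
    have eq: "hyp_sum (Suc n) x y z = hyp_sum n x y z +
        pochhammer x n * pochhammer y n * pochhammer z n * f" for x y z
      by (simp add: hyp_sum_def f_def power_divide)
    show "p_integral_cong p (p\<^sup>2)
      (hyp_sum (Suc n) (of_nat a + of_nat p * s) (of_nat b + of_nat p * t) (of_nat c + of_nat p * u))
      (P + ?q * (s * Q + t * R + u * V) +
        (A + ?q * (s * A')) * (B + ?q * (t * B')) * (C + ?q * (u * C')) * f)"
      unfolding eq
      by (intro p_integral_cong_add p_integral_cong_mult cong A B C stu p f p_integral_cong_refl)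
    show "p_integral_cong p (p\<^sup>2) (P + ?q * (s * Q + t * R + u * V) +
        (A + ?q * (s * A')) * (B + ?q * (t * B')) * (C + ?q * (u * C')) * f)
      (P' + of_nat p * (s * Q' + t * R' + u * V'))"
    \<comment> \<open>The witness collects the products of two or three first-order parts, divided
      by \<open>p\<^sup>2\<close>; the triple product keeps one factor \<open>p\<close>.\<close>
    proof (rule p_integral_congI[OF p, where c = "f * (s * t * A' * B' * C + s * u * A' * B * C' +
          t * u * A * B' * C' + ?q * s * t * u * A' * B' * C')"])
      show "p_integral p (P' + of_nat p * (s * Q' + t * R' + u * V'))"
        unfolding P'_def Q'_def R'_def V'_def by (intro p_integral_intros p integral stu)
    qed (intro p_integral_intros p integral stu,
         unfold P'_def Q'_def R'_def V'_def of_nat_power, algebra)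
  qed
  moreover have "p_integral p P'" "p_integral p Q'" "p_integral p R'" "p_integral p V'"
    unfolding P'_def Q'_def R'_def V'_def by (intro p_integral_intros p integral)+
  ultimately show ?case by blast
qed

section \<open>Vanishing of terminating sums\<close>

text \<open>The shift by 1 preserves degree and leading coefficient, so the leading terms
  cancel.\<close>

lemma degree_diff_pcompose_shift_less:
  fixes q :: "'a::idom poly"
  assumes "degree q > 0"
  shows "degree (q - pcompose q [:1, 1:]) < degree q"
proof (rule degree_lessI)
  show "q - pcompose q [:1, 1:] \<noteq> 0 \<or> degree q > 0" using assms by simp
  have "lead_coeff (pcompose q [:1, 1:]) = lead_coeff q"
    by (simp add: lead_coeff_comp)
  moreover have "degree (pcompose q [:1, 1:]) = degree q"
    by (simp add: degree_pcompose)
  ultimately show "\<forall>k\<ge>degree q. coeff (q - pcompose q [:1, 1:]) k = 0"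
    by (metis coeff_diff coeff_eq_0 diff_self le_neq_implies_less)
qed

text \<open>Pascal's rule turns the difference of order \<open>n + 1\<close> of \<open>q\<close>
  into the difference of order \<open>n\<close> of \<open>q(x) - q(x+1)\<close>, whose degree is
  smaller.\<close>

lemma alternating_binomial_sum_poly:
  fixes q :: "'a::idom poly"
  assumes "degree q < n"
  shows "(\<Sum>k\<le>n. (-1) ^ k * of_nat (n choose k) * poly q (of_nat k)) = 0"
  using assms
proof (induction n arbitrary: q)
  case 0
  then show ?case by simp
next
  case (Suc n)
  let ?r = "q - pcompose q [:1, 1:]"
  have "(\<Sum>k\<le>Suc n. (-1) ^ k * of_nat (Suc n choose k) * poly q (of_nat k)) =
      poly q 0 + (\<Sum>k\<le>n. (-1) ^ Suc k * of_nat (Suc n choose Suc k) * poly q (of_nat (Suc k)))"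
    by (subst sum.atMost_Suc_shift) simp
  also have "\<dots> = (poly q 0 + (\<Sum>k\<le>n. (-1) ^ Suc k * of_nat (n choose Suc k) * poly q (of_nat (Suc k))))
      - (\<Sum>k\<le>n. (-1) ^ k * of_nat (n choose k) * poly q (of_nat (Suc k)))"
    by (simp add: algebra_simps sum.distrib sum_negf sum_subtractf)
  also have "poly q 0 + (\<Sum>k\<le>n. (-1) ^ Suc k * of_nat (n choose Suc k) * poly q (of_nat (Suc k))) =
      (\<Sum>k\<le>Suc n. (-1) ^ k * of_nat (n choose k) * poly q (of_nat k))"
    by (subst sum.atMost_Suc_shift) simp
  also have "\<dots> = (\<Sum>k\<le>n. (-1) ^ k * of_nat (n choose k) * poly q (of_nat k))"
    by (simp add: binomial_eq_0)
  also have "\<dots> - (\<Sum>k\<le>n. (-1) ^ k * of_nat (n choose k) * poly q (of_nat (Suc k))) =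
      (\<Sum>k\<le>n. (-1) ^ k * of_nat (n choose k) * poly ?r (of_nat k))"
    by (simp add: sum_subtractf [symmetric] poly_pcompose algebra_simps)
  also have "\<dots> = 0"
  \<comment> \<open>A constant \<open>q\<close> has no degree left to lose, but its difference is
    the zero polynomial.\<close>
  proof (cases "degree q = 0")
    case True
    then have "?r = 0" by (metis degree_eq_zeroE diff_self pcompose_const)
    then show ?thesis by simp
  next
    case False
    then have "degree ?r < n"
      using Suc.prems degree_diff_pcompose_shift_less[of q] by linarith
    then show ?thesis by (rule Suc.IH)
  qed
  finally show ?case .
qed

text \<open>Both sides equal \<open>(m + k)! / (m! k!)\<close>. The right-hand form shows that the
  quotient is polynomial in \<open>k\<close>.\<close>

lemma pochhammer_div_fact_swap:
  "pochhammer (of_nat (Suc m)) k / fact k = (pochhammer (of_nat k + 1) m / fact m :: 'a::field_char_0)"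
proof -
  have "(fact (m + k) :: 'a) = fact m * pochhammer (of_nat (Suc m)) k"
    unfolding pochhammer_fact pochhammer_product'[of 1 m k] by (simp add: add.commute)
  moreover have "(fact (k + m) :: 'a) = fact k * pochhammer (of_nat k + 1) m"
    unfolding pochhammer_fact pochhammer_product'[of 1 k m] by (simp add: add.commute)
  ultimately show ?thesis by (simp add: add.commute field_simps)
qed

lemma pochhammer_poly_exists:
  "\<exists>q :: 'a::idom poly. degree q \<le> m \<and> (\<forall>x. poly q x = pochhammer (x + 1) m)"
proof (induction m)
  case 0
  show ?case by (rule exI[of _ 1]) simp
next
  case (Suc m)
  then obtain q :: "'a poly" where q: "degree q \<le> m" "\<And>x. poly q x = pochhammer (x + 1) m"
    by blast
  have "degree (q * [:1 + of_nat m, 1:]) \<le> Suc m"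
    by (rule order_trans[OF degree_mult_le]) (use q(1) in simp)
  moreover have "poly (q * [:1 + of_nat m, 1:]) x = pochhammer (x + 1) (Suc m)" for x
    by (simp add: q(2) pochhammer_Suc algebra_simps)
  ultimately show ?case by blast
qed

text \<open>Pairing each upper parameter with one \<open>k!\<close> gives a signed binomial
  coefficient times a polynomial in \<open>k\<close> of degree at most
  \<open>(b-1) + (c-1) = n - 1\<close>.\<close>

lemma hyp_sum_terminating_eq_0:
  assumes "n < N" "b \<ge> 1" "c \<ge> 1" "b + c = n + 1"
  shows "hyp_sum N (- of_nat n) (of_nat b) (of_nat c) = 0"
proof -
  obtain b' c' where bc: "b = Suc b'" "c = Suc c'"
    using assms by (metis Suc_le_D One_nat_def)
  obtain q :: "rat poly" where q: "degree q \<le> b'" "\<And>x. poly q x = pochhammer (x + 1) b'"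
    using pochhammer_poly_exists by blast
  obtain r :: "rat poly" where r: "degree r \<le> c'" "\<And>x. poly r x = pochhammer (x + 1) c'"
    using pochhammer_poly_exists by blast
  define h where "h = smult (1 / (fact b' * fact c')) (q * r)"
  have deg: "degree h < n"
    using degree_mult_le[of q r] q(1) r(1) assms bc by (simp add: h_def)
  have "pochhammer (- of_nat n) k * pochhammer (of_nat b) k * pochhammer (of_nat c) k / fact k ^ 3 =
      (-1) ^ k * of_nat (n choose k) * poly h (of_nat k)" for k
  proof -
    have "pochhammer (- of_nat n) k / fact k = (-1) ^ k * (of_nat (n choose k) :: rat)"
      by (simp add: binomial_gbinomial gbinomial_pochhammer)
    moreover have "pochhammer (of_nat b) k / fact k * (pochhammer (of_nat c) k / fact k) =
        poly h (of_nat k)"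
      unfolding bc pochhammer_div_fact_swap by (simp add: h_def q(2) r(2))
    moreover have "x * y * z / w ^ 3 = x / w * (y / w * (z / w))" for x y z w :: rat
      by (simp add: power3_eq_cube)
    ultimately show ?thesis by (simp only:)
  qed
  then have "hyp_sum N (- of_nat n) (of_nat b) (of_nat c) =
      (\<Sum>k<N. (-1) ^ k * of_nat (n choose k) * poly h (of_nat k))"
    by (simp add: hyp_sum_def)
  \<comment> \<open>The terms with \<open>k > n\<close> vanish through the binomial
    coefficient.\<close>
  also have "\<dots> = (\<Sum>k\<le>n. (-1) ^ k * of_nat (n choose k) * poly h (of_nat k))"
    by (rule sum.mono_neutral_right) (use \<open>n < N\<close> in auto)
  also have "\<dots> = 0" by (rule alternating_binomial_sum_poly[OF deg])
  finally show ?thesis .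
qed

section \<open>Affine interpolation from the three vanishing points\<close>

lemma hyp_sum_cong_0:
  assumes p: "prime p" and abc: "a \<ge> 1" "b \<ge> 1" "c \<ge> 1" "a + b + c = p + 1"
    and stu: "p_integral p s" "p_integral p t" "p_integral p u" "s + t + u = - 1"
  shows "p_integral_cong p (p\<^sup>2)
    (hyp_sum p (of_nat a + of_nat p * s) (of_nat b + of_nat p * t) (of_nat c + of_nat p * u)) 0"
proof -
  let ?q = "of_nat p :: rat"
  let ?S = "\<lambda>s t u. hyp_sum p (of_nat a + ?q * s) (of_nat b + ?q * t) (of_nat c + ?q * u)"
  obtain P Q R V where int: "p_integral p P" "p_integral p Q" "p_integral p R" "p_integral p V"
    and cong: "\<And>s t u. p_integral p s \<Longrightarrow> p_integral p t \<Longrightarrow> p_integral p u \<Longrightarrow>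
      p_integral_cong p (p\<^sup>2) (?S s t u) (P + ?q * (s * Q + t * R + u * V))"
    using hyp_sum_expansion[OF p order_refl, of a b c] by blast
  \<comment> \<open>Setting one of \<open>s\<close>, \<open>t\<close>, \<open>u\<close> to -1 makes
    the corresponding parameter a non-positive integer, so the sum terminates before
    \<open>p\<close>.\<close>
  have shift: "of_nat x + ?q * (-1) = - of_nat (p - x)" if "x \<le> p" for x
    using that by (simp add: of_nat_diff)
  have perm: "hyp_sum p x y z = hyp_sum p y x z" "hyp_sum p x y z = hyp_sum p z x y" for x y z
    by (simp_all add: hyp_sum_def mult_ac)
  have "?S (-1) 0 0 = 0"
    using hyp_sum_terminating_eq_0[of "p - a" p b c] shift[of a] abc by simp
  then have 1: "p_integral_cong p (p\<^sup>2) 0 (P - ?q * Q)"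
    using cong[of "-1" 0 0] p by (simp add: p_integral_intros)
  have "?S 0 (-1) 0 = 0"
    using hyp_sum_terminating_eq_0[of "p - b" p a c] shift[of b] abc by (simp add: perm(1))
  then have 2: "p_integral_cong p (p\<^sup>2) 0 (P - ?q * R)"
    using cong[of 0 "-1" 0] p by (simp add: p_integral_intros)
  have "?S 0 0 (-1) = 0"
    using hyp_sum_terminating_eq_0[of "p - c" p a b] shift[of c] abc by (subst perm(2)) simp
  then have 3: "p_integral_cong p (p\<^sup>2) 0 (P - ?q * V)"
    using cong[of 0 0 "-1"] p by (simp add: p_integral_intros)
  \<comment> \<open>The weights \<open>-s\<close>, \<open>-t\<close>, \<open>-u\<close> add up to 1,
    so they express \<open>(s, t, u)\<close> as an affine combination of the three points.\<close>
  have "p_integral_cong p (p\<^sup>2) (- s * 0 + - t * 0 + - u * 0)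
      (- s * (P - ?q * Q) + - t * (P - ?q * R) + - u * (P - ?q * V))"
    by (intro p_integral_cong_add p_integral_cong_mult 1 2 3 p p_integral_cong_refl
        p_integral_minus stu)
  also have "- s * (P - ?q * Q) + - t * (P - ?q * R) + - u * (P - ?q * V) =
      - (s + t + u) * P + ?q * (s * Q + t * R + u * V)"
    by (simp add: algebra_simps)
  finally have "p_integral_cong p (p\<^sup>2) 0 (P + ?q * (s * Q + t * R + u * V))"
    by (simp add: stu(4))
  then show ?thesis
    using cong[OF stu(1-3)] p_integral_cong_trans[OF p] p_integral_cong_sym[OF p] by blast
qed

theorem theorem1:
  fixes p :: nat and \<alpha> \<beta> :: rat
  assumes "prime p" and "odd p"
    and "p_integral p \<alpha>" and "p_integral p \<beta>"
    and "least_residue p \<alpha> \<ge> 1" and "least_residue p \<beta> \<ge> 1"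
    and "least_residue p \<alpha> + least_residue p \<beta> \<le> p"
  shows "truncated_hypergeometric [\<alpha>, \<beta>, 1 - \<alpha> - \<beta>] [1, 1] 1 p =
           (\<Sum>k = 0..p - 1. pochhammer \<alpha> k * pochhammer \<beta> k * pochhammer (1 - \<alpha> - \<beta>) k / fact k ^ 3) \<and>
         p_integral_cong p (p ^ 2)
           (truncated_hypergeometric [\<alpha>, \<beta>, 1 - \<alpha> - \<beta>] [1, 1] 1 p) 0"
proof -
  note p = \<open>prime p\<close>
  \<comment> \<open>\<open>c\<close> is congruent to \<open>1 - \<alpha> - \<beta>\<close> modulo
    \<open>p\<close>; the natural subtraction does not truncate and \<open>c \<ge> 1\<close>, since
    \<open>a + b \<le> p\<close>.\<close>
  define a b c where "a = least_residue p \<alpha>" and "b = least_residue p \<beta>" and "c = p + 1 - (a + b)"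
  have "p_integral_cong p p \<alpha> (of_nat a)" "p_integral_cong p p \<beta> (of_nat b)"
    using theI'[OF least_residue_unique_exists[OF p assms(3)]]
      theI'[OF least_residue_unique_exists[OF p assms(4)]]
    by (simp_all add: a_def b_def least_residue_def)
  then obtain s t where s: "p_integral p s" "\<alpha> = of_nat a + of_nat p * s"
    and t: "p_integral p t" "\<beta> = of_nat b + of_nat p * t"
    by (metis p_integral_congE)
  have ab: "a \<ge> 1" "b \<ge> 1" "a + b \<le> p"
    using assms(5-7) by (simp_all add: a_def b_def)
  then have c: "c \<ge> 1" "a + b + c = p + 1" by (simp_all add: c_def)
  have "of_nat a + of_nat b + of_nat c = (of_nat p + 1 :: rat)"
    using arg_cong[OF c(2), of "of_nat :: nat \<Rightarrow> rat"] by simp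
  \<comment> \<open>The extra -1 in the third coefficient compensates the \<open>p\<close> in
    \<open>a + b + c = p + 1\<close>; it is what makes the coefficients sum to -1.\<close>
  then have \<gamma>: "1 - \<alpha> - \<beta> = of_nat c + of_nat p * (- 1 - s - t)"
    by (simp add: s(2) t(2) algebra_simps)
  have "p_integral p (- 1 - s - t)" by (intro p_integral_intros p s t)
  then have "p_integral_cong p (p\<^sup>2) (hyp_sum p \<alpha> \<beta> (1 - \<alpha> - \<beta>)) 0"
    unfolding \<gamma> unfolding s(2) t(2) by (intro hyp_sum_cong_0 p ab c s t) simp_all
  moreover have "truncated_hypergeometric [\<alpha>, \<beta>, 1 - \<alpha> - \<beta>] [1, 1] 1 p = hyp_sum p \<alpha> \<beta> (1 - \<alpha> - \<beta>)"
    by (simp add: truncated_hypergeometric_def hyp_sum_def pochhammer_fact [symmetric]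
        power3_eq_cube mult.assoc)
  moreover have "{..<p} = {0..p - 1}"
    using prime_gt_0_nat[OF p] by auto
  ultimately show ?thesis by (simp add: hyp_sum_def)
qed

end
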